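(* Let $T_1:\mathcal{M}\to\mathcal{M}$ and $T_2:\mathcal{N}\to\mathcal{N}$ be two topologically conjugate dynamical systems with homeomorphism $h:\mathcal{N}\to\mathcal{M}$, i.e. $T_1=h\circ T_2\circ h^{-1}$. Let $\Psi$ be a basis of observables on $\mathcal{M}$ such that the Koopman operator of $(T_1,\mathcal{M})$ has representation $\mathbb{U}_\Psi$ with respect to $\Psi$. Take as observables on $(T_2,\mathcal{N})$ the functions $\Theta=\Psi\circ h$, and let $\mathbb{U}_\Theta$ denote the representation of the Koopman operator of $(T_2,\mathcal{N})$ with respect to $\Theta$. Then $$\mathbb{U}_\Psi=\mathbb{U}_\Theta .$$
   Context: $\mathcal{M}$ and $\mathcal{N}$ are the state spaces (topological spaces) of the two discrete-time systems $x_{t+1}=T_1(x_t)$ and $y_{t+1}=T_2(y_t)$. $T_1$ and $T_2$ are topologically conjugate if there is a homeomorphism $h:\mathcal{N}\to\mathcal{M}$ with $T_1=h\circ T_2\circ h^{-1}$; $h$ is then called a topological conjugacy. An observable on a state space $X$ is a function $\psi:X\to\mathbb{C}$. The Koopman operator $\mathbb{U}$ of a system $S:X\to X$ acts on observables by $[\mathbb{U}\psi](x)=\psi(S(x))$. A basis of observables $\Psi=(\psi_j)_{j\in J}$ on $X$ is a linearly independent family of observables, a basis of the space of observables it spans. The representation of the Koopman operator of $S$ with respect to $\Psi$, when the span of $\Psi$ is mapped to itself by the Koopman operator, is the matrix $\mathbb{U}_\Psi$ (indexed by $J\times J$, each row having finitely many nonzero entries) determined by $\Psi(S(x))=\mathbb{U}_\Psi\Psi(x)$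 for all $x\in X$, where $\Psi(x)$ is the column vector $(\psi_j(x))_{j\in J}$. The family $\Psi\circ h$ is $(\psi_j\circ h)_{j\in J}$. *)

theory Defs
  imports "HOL-Analysis.Abstract_Topology" "HOL-Library.FuncSet" Complex_Main
begin

text \<open>
  A state space is an abstract topology \<open>X\<close> with point set \<open>topspace X\<close>. An observable is a
  function on that point set; it is represented by its extensional version (\<open>undefined\<close> off
  \<open>topspace X\<close>), so that equality of observables is equality of HOL functions.
\<close>

definition observables :: "'a topology \<Rightarrow> ('a \<Rightarrow> complex) set" where
  "observables X = topspace X \<rightarrow>\<^sub>E UNIV"

definition koopman :: "'a topology \<Rightarrow> ('a \<Rightarrow> 'a) \<Rightarrow> ('a \<Rightarrow> complex) \<Rightarrow> ('a \<Rightarrow> complex)" where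
  "koopman X S \<psi> = (\<lambda>x\<in>topspace X. \<psi> (S x))"

definition topological_conjugacy ::
    "'a topology \<Rightarrow> ('a \<Rightarrow> 'a) \<Rightarrow> 'b topology \<Rightarrow> ('b \<Rightarrow> 'b) \<Rightarrow> ('b \<Rightarrow> 'a) \<Rightarrow> bool" where
  "topological_conjugacy M T1 N T2 h \<longleftrightarrow>
     homeomorphic_map N M h \<and>
     (\<forall>x\<in>topspace M. T1 x = h (T2 (inv_into (topspace N) h x)))"

definition observable_span ::
    "'a topology \<Rightarrow> 'j set \<Rightarrow> ('j \<Rightarrow> 'a \<Rightarrow> complex) \<Rightarrow> ('a \<Rightarrow> complex) set" where
  "observable_span X J \<Psi> =
     {(\<lambda>x\<in>topspace X. \<Sum>j\<in>F. c j * \<Psi> j x) | F c. finite F \<and> F \<subseteq> J}"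

definition observable_basis :: "'a topology \<Rightarrow> 'j set \<Rightarrow> ('j \<Rightarrow> 'a \<Rightarrow> complex) \<Rightarrow> bool" where
  "observable_basis X J \<Psi> \<longleftrightarrow>
     (\<forall>j\<in>J. \<Psi> j \<in> observables X) \<and>
     (\<forall>F c. finite F \<and> F \<subseteq> J \<and> (\<forall>x\<in>topspace X. (\<Sum>j\<in>F. c j * \<Psi> j x) = 0)
        \<longrightarrow> (\<forall>j\<in>F. c j = 0))"

definition koopman_invariant ::
    "'a topology \<Rightarrow> ('a \<Rightarrow> 'a) \<Rightarrow> 'j set \<Rightarrow> ('j \<Rightarrow> 'a \<Rightarrow> complex) \<Rightarrow> bool" where
  "koopman_invariant X S J \<Psi> \<longleftrightarrow>
     koopman X S ` observable_span X J \<Psi> \<subseteq> observable_span X J \<Psi>"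

text \<open>
  A \<open>J \<times> J\<close> matrix whose rows have finite support. Entries off \<open>J \<times> J\<close> are fixed to \<open>0\<close>, so
  that equality of matrices is equality of HOL functions.
\<close>

definition row_finite_matrix :: "'j set \<Rightarrow> ('j \<Rightarrow> 'j \<Rightarrow> complex) \<Rightarrow> bool" where
  "row_finite_matrix J U \<longleftrightarrow>
     (\<forall>i\<in>J. finite {j\<in>J. U i j \<noteq> 0}) \<and>
     (\<forall>i j. i \<notin> J \<or> j \<notin> J \<longrightarrow> U i j = 0)"

definition represents_koopman ::
    "'a topology \<Rightarrow> ('a \<Rightarrow> 'a) \<Rightarrow> 'j set \<Rightarrow> ('j \<Rightarrow> 'a \<Rightarrow> complex) \<Rightarrow>
     ('j \<Rightarrow> 'j \<Rightarrow> complex) \<Rightarrow> bool" where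
  "represents_koopman X S J \<Psi> U \<longleftrightarrow>
     row_finite_matrix J U \<and>
     (\<forall>x\<in>topspace X. \<forall>i\<in>J. \<Psi> i (S x) = (\<Sum>j | j \<in> J \<and> U i j \<noteq> 0. U i j * \<Psi> j x))"

definition koopman_matrix ::
    "'a topology \<Rightarrow> ('a \<Rightarrow> 'a) \<Rightarrow> 'j set \<Rightarrow> ('j \<Rightarrow> 'a \<Rightarrow> complex) \<Rightarrow>
     ('j \<Rightarrow> 'j \<Rightarrow> complex)" where
  "koopman_matrix X S J \<Psi> = (THE U. represents_koopman X S J \<Psi> U)"

text \<open>
  The description in \<open>koopman_matrix\<close> is proper whenever \<open>\<Psi>\<close> is a basis of observables whose
  span is invariant.
\<close>

lemma represents_koopman_ex1:
  assumes S: "S \<in> topspace X \<rightarrow> topspace X"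
    and basis: "observable_basis X J \<Psi>"
    and inv: "koopman_invariant X S J \<Psi>"
  shows "\<exists>!U. represents_koopman X S J \<Psi> U"
proof (rule ex_ex1I)
  have "\<exists>F c. finite F \<and> F \<subseteq> J \<and> (\<forall>x\<in>topspace X. \<Psi> i (S x) = (\<Sum>j\<in>F. c j * \<Psi> j x))"
    if i: "i \<in> J" for i
  proof -
    have "(\<lambda>x\<in>topspace X. \<Sum>j\<in>{i}. 1 * \<Psi> j x) \<in> observable_span X J \<Psi>"
      unfolding observable_span_def mem_Collect_eq using i
      by (intro exI[of _ "{i}"] exI[of _ "\<lambda>_. 1"]) auto
    then have "koopman X S (\<lambda>x\<in>topspace X. \<Sum>j\<in>{i}. 1 * \<Psi> j x) \<in> observable_span X J \<Psi>"
      using inv unfolding koopman_invariant_def by blast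
    then obtain F c where F: "finite F" "F \<subseteq> J"
      and eq: "koopman X S (\<lambda>x\<in>topspace X. \<Sum>j\<in>{i}. 1 * \<Psi> j x)
                 = (\<lambda>x\<in>topspace X. \<Sum>j\<in>F. c j * \<Psi> j x)"
      unfolding observable_span_def mem_Collect_eq by blast
    have "\<Psi> i (S x) = (\<Sum>j\<in>F. c j * \<Psi> j x)" if "x \<in> topspace X" for x
      using fun_cong[OF eq, of x] that S by (auto simp: koopman_def Pi_iff)
    with F show ?thesis by blast
  qed
  then obtain F c where F: "\<And>i. i \<in> J \<Longrightarrow> finite (F i) \<and> F i \<subseteq> J \<and>
      (\<forall>x\<in>topspace X. \<Psi> i (S x) = (\<Sum>j\<in>F i. c i j * \<Psi> j x))"
    by metis
  define U where "U = (\<lambda>i j. if i \<in> J \<and> j \<in> F i then c i j else 0)"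
  have sub: "{j \<in> J. U i j \<noteq> 0} \<subseteq> F i" for i
    by (auto simp: U_def)
  have eq: "\<Psi> i (S x) = (\<Sum>j | j \<in> J \<and> U i j \<noteq> 0. U i j * \<Psi> j x)"
    if i: "i \<in> J" and x: "x \<in> topspace X" for i x
  proof -
    have "\<Psi> i (S x) = (\<Sum>j\<in>F i. U i j * \<Psi> j x)"
    proof -
      have "\<Psi> i (S x) = (\<Sum>j\<in>F i. c i j * \<Psi> j x)"
        using F[OF i] x by blast
      also have "\<dots> = (\<Sum>j\<in>F i. U i j * \<Psi> j x)"
        using i by (intro sum.cong) (auto simp: U_def)
      finally show ?thesis .
    qed
    also have "\<dots> = (\<Sum>j | j \<in> J \<and> U i j \<noteq> 0. U i j * \<Psi> j x)"
    proof (rule sum.mono_neutral_right)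
      show "finite (F i)" using F[OF i] by blast
      show "{j \<in> J. U i j \<noteq> 0} \<subseteq> F i" by (rule sub)
      show "\<forall>k\<in>F i - {j \<in> J. U i j \<noteq> 0}. U i k * \<Psi> k x = 0"
      proof
        fix k
        assume k: "k \<in> F i - {j \<in> J. U i j \<noteq> 0}"
        moreover have "k \<in> J" using k F[OF i] by blast
        ultimately show "U i k * \<Psi> k x = 0" by simp
      qed
    qed
    finally show ?thesis .
  qed
  have "finite {j \<in> J. U i j \<noteq> 0}" if "i \<in> J" for i
    using F[OF that] sub[of i] finite_subset by blast
  moreover have "U i j = 0" if "i \<notin> J \<or> j \<notin> J" for i j
  proof (cases "i \<in> J")
    case True
    then have "j \<notin> F i" using that F[OF True] by blast
    then show ?thesis by (simp add: U_def)
  qed (simp add: U_def)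
  ultimately have "row_finite_matrix J U"
    unfolding row_finite_matrix_def by blast
  then have "represents_koopman X S J \<Psi> U"
    unfolding represents_koopman_def using eq by (intro conjI ballI)
  then show "\<exists>U. represents_koopman X S J \<Psi> U" by (rule exI[of _ U])
next
  fix U V
  assume U: "represents_koopman X S J \<Psi> U" and V: "represents_koopman X S J \<Psi> V"
  have rowU: "row_finite_matrix J U" and rowV: "row_finite_matrix J V"
    using U V by (simp_all only: represents_koopman_def)
  have "U i j = V i j" for i j
  proof (cases "i \<in> J \<and> j \<in> J")
    case False
    then show ?thesis
      using rowU rowV by (simp add: row_finite_matrix_def)
  next
    case True
    then have i: "i \<in> J" and j: "j \<in> J" by auto
    define F where "F = insert j ({j\<in>J. U i j \<noteq> 0} \<union> {j\<in>J. V i j \<noteq> 0})"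
    have finU: "finite {j\<in>J. U i j \<noteq> 0}" and finV: "finite {j\<in>J. V i j \<noteq> 0}"
      using rowU rowV i by (simp_all add: row_finite_matrix_def)
    have fin: "finite F"
      unfolding F_def using finU finV by blast
    have FJ: "F \<subseteq> J"
      unfolding F_def using j by blast
    have "(\<Sum>j\<in>F. (U i j - V i j) * \<Psi> j x) = 0" if x: "x \<in> topspace X" for x
    proof -
      have "\<Psi> i (S x) = (\<Sum>j | j \<in> J \<and> U i j \<noteq> 0. U i j * \<Psi> j x)"
        using U x i unfolding represents_koopman_def by blast
      also have "\<dots> = (\<Sum>j\<in>F. U i j * \<Psi> j x)"
      proof (rule sum.mono_neutral_left[OF fin])
        show "\<forall>k\<in>F - {j \<in> J. U i j \<noteq> 0}. U i k * \<Psi> k x = 0"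
          using FJ by auto
      qed (auto simp: F_def)
      finally have sumU: "\<Psi> i (S x) = (\<Sum>j\<in>F. U i j * \<Psi> j x)" .
      have "\<Psi> i (S x) = (\<Sum>j | j \<in> J \<and> V i j \<noteq> 0. V i j * \<Psi> j x)"
        using V x i unfolding represents_koopman_def by blast
      also have "\<dots> = (\<Sum>j\<in>F. V i j * \<Psi> j x)"
      proof (rule sum.mono_neutral_left[OF fin])
        show "\<forall>k\<in>F - {j \<in> J. V i j \<noteq> 0}. V i k * \<Psi> k x = 0"
          using FJ by auto
      qed (auto simp: F_def)
      finally have sumV: "\<Psi> i (S x) = (\<Sum>j\<in>F. V i j * \<Psi> j x)" .
      show ?thesis
        using sumU sumV by (simp add: left_diff_distrib sum_subtractf)
    qed
    then have zero: "finite F \<and> F \<subseteq> J \<and>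
        (\<forall>x\<in>topspace X. (\<Sum>j\<in>F. (U i j - V i j) * \<Psi> j x) = 0)"
      using fin FJ by (intro conjI ballI)
    note indep = conjunct2[OF basis[unfolded observable_basis_def]]
    have "\<forall>k\<in>F. U i k - V i k = 0"
      by (rule mp[OF spec[OF spec[OF indep, of F], of "\<lambda>k. U i k - V i k"] zero])
    moreover have "j \<in> F" by (simp add: F_def)
    ultimately have "U i j - V i j = 0" by (rule bspec)
    then show ?thesis by simp
  qed
  then show "U = V" by (intro ext)
qed

end

theory Submission
  imports Defs
begin

text \<open>
  A conjugacy \<open>h\<close> transports observables: pulling back along \<open>h\<close> sends an observable \<open>f\<close> on
  \<open>M\<close> to \<open>f \<circ> h\<close> on \<open>N\<close>. This map is linear, it is injective because \<open>h\<close> is onto, and it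
  intertwines the Koopman operators because \<open>h \<circ> T2 = T1 \<circ> h\<close>. Linear independence therefore
  passes from \<open>\<Psi>\<close> to \<open>\<Psi> \<circ> h\<close>, and so does invariance of the span. Evaluated at \<open>y\<close>, the system
  of equations saying that a matrix \<open>U\<close> represents the Koopman operator with respect to \<open>\<Psi> \<circ> h\<close>
  is the system for \<open>\<Psi>\<close> evaluated at \<open>h y\<close>. As \<open>h y\<close> runs through all of \<open>M\<close>, the two systems have
  the same solutions \<open>U\<close>, and hence the same unique solution.
\<close>

lemma topological_conjugacy_imp_surjective_semiconjugacy:
  assumes "topological_conjugacy M T1 N T2 h"
  shows "h ` topspace N = topspace M"
    and "\<And>y. y \<in> topspace N \<Longrightarrow> T1 (h y) = h (T2 y)"
proof -
  have hom: "homeomorphic_map N M h"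
    and conj: "\<And>x. x \<in> topspace M \<Longrightarrow> T1 x = h (T2 (inv_into (topspace N) h x))"
    using assms unfolding topological_conjugacy_def by blast+
  show img: "h ` topspace N = topspace M"
    using hom by (rule homeomorphic_imp_surjective_map)
  fix y assume y: "y \<in> topspace N"
  have "inv_into (topspace N) h (h y) = y"
    using homeomorphic_imp_injective_map[OF hom] y by (rule inv_into_f_f)
  moreover have "h y \<in> topspace M"
    using img y by blast
  ultimately show "T1 (h y) = h (T2 y)"
    using conj by simp
qed

text \<open>
  A linear relation among the pulled-back functions is a linear relation among the original
  ones at the points of the image of \<open>h\<close>, which is the whole space.
\<close>

lemma observable_basis_pullback:
  assumes img: "h ` topspace N = topspace M"
    and basis: "observable_basis M J \<Psi>"
  shows "observable_basis N J (\<lambda>j. compose (topspace N) (\<Psi> j) h)"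
  unfolding observable_basis_def
proof (intro conjI ballI allI impI)
  fix j
  show "compose (topspace N) (\<Psi> j) h \<in> observables N"
    by (simp add: observables_def compose_def)
next
  fix F c j
  assume rel: "finite F \<and> F \<subseteq> J \<and>
      (\<forall>y\<in>topspace N. (\<Sum>j\<in>F. c j * compose (topspace N) (\<Psi> j) h y) = 0)"
    and j: "j \<in> F"
  have "\<forall>x\<in>topspace M. (\<Sum>j\<in>F. c j * \<Psi> j x) = 0"
    using rel by (simp add: compose_eq flip: img)
  with rel j basis show "c j = 0"
    unfolding observable_basis_def by blast
qed

lemma observable_span_pullback:
  assumes img: "h ` topspace N = topspace M"
  shows "observable_span N J (\<lambda>j. compose (topspace N) (\<Psi> j) h)
           = (\<lambda>f. compose (topspace N) f h) ` observable_span M J \<Psi>"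
proof -
  have "(\<lambda>y\<in>topspace N. \<Sum>j\<in>F. c j * compose (topspace N) (\<Psi> j) h y)
          = compose (topspace N) (\<lambda>x\<in>topspace M. \<Sum>j\<in>F. c j * \<Psi> j x) h" for F c
    using img by (auto simp: compose_def fun_eq_iff)
  then show ?thesis
    unfolding observable_span_def by auto
qed

lemma koopman_pullback:
  assumes img: "h ` topspace N = topspace M"
    and T2: "T2 \<in> topspace N \<rightarrow> topspace N"
    and semi: "\<And>y. y \<in> topspace N \<Longrightarrow> T1 (h y) = h (T2 y)"
  shows "koopman N T2 (compose (topspace N) f h) = compose (topspace N) (koopman M T1 f) h"
  using assms by (auto simp: koopman_def compose_def fun_eq_iff Pi_iff)

lemma koopman_invariant_pullback:
  assumes img: "h ` topspace N = topspace M"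
    and T2: "T2 \<in> topspace N \<rightarrow> topspace N"
    and semi: "\<And>y. y \<in> topspace N \<Longrightarrow> T1 (h y) = h (T2 y)"
    and inv: "koopman_invariant M T1 J \<Psi>"
  shows "koopman_invariant N T2 J (\<lambda>j. compose (topspace N) (\<Psi> j) h)"
  using inv
  by (auto simp: koopman_invariant_def observable_span_pullback[OF img]
      koopman_pullback[OF img T2 semi])

text \<open>
  Surjectivity of \<open>h\<close> turns the quantifier over points of \<open>M\<close> into one over points \<open>h y\<close>. The
  equations at \<open>y\<close> and at \<open>h y\<close> then agree, by \<open>\<Psi> i (h (T2 y)) = \<Psi> i (T1 (h y))\<close>.
\<close>

lemma represents_koopman_pullback_iff:
  assumes img: "h ` topspace N = topspace M"
    and T2: "T2 \<in> topspace N \<rightarrow> topspace N"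
    and semi: "\<And>y. y \<in> topspace N \<Longrightarrow> T1 (h y) = h (T2 y)"
  shows "represents_koopman N T2 J (\<lambda>j. compose (topspace N) (\<Psi> j) h) U
           \<longleftrightarrow> represents_koopman M T1 J \<Psi> U"
  using T2 by (simp add: represents_koopman_def compose_eq semi Pi_iff flip: img)

theorem theorem13:
  fixes M :: "'m topology" and N :: "'n topology"
    and T1 :: "'m \<Rightarrow> 'm" and T2 :: "'n \<Rightarrow> 'n" and h :: "'n \<Rightarrow> 'm"
    and J :: "'j set" and \<Psi> :: "'j \<Rightarrow> 'm \<Rightarrow> complex" and \<Theta> :: "'j \<Rightarrow> 'n \<Rightarrow> complex"
  assumes "T1 \<in> topspace M \<rightarrow> topspace M"
    and "T2 \<in> topspace N \<rightarrow> topspace N"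
    and "topological_conjugacy M T1 N T2 h"
    and "observable_basis M J \<Psi>"
    and "koopman_invariant M T1 J \<Psi>"
    and "\<Theta> = (\<lambda>j. compose (topspace N) (\<Psi> j) h)"
  shows "observable_basis N J \<Theta> \<and> koopman_invariant N T2 J \<Theta> \<and>
         koopman_matrix M T1 J \<Psi> = koopman_matrix N T2 J \<Theta>"
proof -
  note img = topological_conjugacy_imp_surjective_semiconjugacy(1)[OF assms(3)]
  note semi = topological_conjugacy_imp_surjective_semiconjugacy(2)[OF assms(3)]
  have "represents_koopman N T2 J \<Theta> = represents_koopman M T1 J \<Psi>"
    unfolding assms(6) using represents_koopman_pullback_iff[OF img assms(2) semi] by (rule ext)
  then have "koopman_matrix M T1 J \<Psi> = koopman_matrix N T2 J \<Theta>"
    by (simp add: koopman_matrix_def)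
  then show ?thesis
    using observable_basis_pullback[OF img assms(4)]
      koopman_invariant_pullback[OF img assms(2) semi assms(5)]
    unfolding assms(6) by blast
qed

end
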